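(* Let $f:\mathbb{R}^n\to\mathbb{R}^n$ be a polynomial (in particular $C^1$) vector field that is asymptotically quasi-homogeneous at infinity of type $\alpha=(\alpha_1,\dots,\alpha_n)$ and order $k+1$. Let $x=T_{para}(y)$ be the new variable given by the quasi-parabolic compactification of type $\alpha$, and let $\tau$ be the new time variable given by $$d\tau=\kappa(y(t))^{k}\left(1-\frac{2c-1}{2c}\kappa(y(t))^{-1}\right)^{-1}dt .$$ Then the vector field on $\mathcal{D}$ that governs $x=T_{para}(y)$ in the time variable $\tau$, where $y$ solves $y'=f(y)$, is $C^1$ on $\overline{\mathcal{D}}$ (that is, it extends to a $C^1$ vector field on $\overline{\mathcal{D}}$).
   Context: Natural numbers are $\ge1$; $\alpha_1,\dots,\alpha_n,k$ are natural numbers, and $\beta_1,\dots,\beta_n,c$ are natural numbers with $\alpha_1\beta_1=\cdots=\alpha_n\beta_n=c$. Quasi-homogeneity: $h:\mathbb{R}^n\to\mathbb{R}$ is homogeneous of type $\alpha$ and order $m$ if $h(r^{\alpha_1}x_1,\dots,r^{\alpha_n}x_n)=r^mh(x)$ for all $x\in\mathbb{R}^n$, $r\in\mathbb{R}$. A vector field $(h_1,\dots,h_n)$ is quasi-homogeneous of type $\alpha$ and order $k+1$ if each $h_j$ is homogeneous of type $\alpha$ and order $k+\alpha_j$. A vector field $f$ is asymptotically quasi-homogeneous at infinity of type $\alpha$ and order $k+1$ if there is a quasi-homogeneous vector field $f_{\alpha,k}$ of type $\alpha$ and order $k+1$ such that for each $j$ $$\lim_{r\to+\infty}r^{-(k+\alpha_j)}\left\{f_j(r^{\alpha_1}x_1,\dots,r^{\alpha_n}x_n)-r^{k+\alpha_j}(f_{\alpha,k})_j(x)\right\}=0$$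 uniformly for $x\in S^{n-1}$. Quasi-parabolic compactification: $p(y)=\left(\sum_{i}y_i^{2\beta_i}\right)^{1/2c}$, $\mathcal{D}=\{x\in\mathbb{R}^n\mid p(x)<1\}$, $\overline{\mathcal{D}}=\{p\le1\}$. For $y\neq0$, $\kappa(y)$ is the unique zero of $\kappa^{2c}-\kappa^{2c-1}-p(y)^{2c}$ in $\{\kappa>\max\{1,p(y)\}\}$, and $\kappa(0)=1$. $T_{para}:\mathbb{R}^n\to\mathcal{D}$, $T_{para}(y)_i=y_i/\kappa(y)^{\alpha_i}$, is a diffeomorphism with inverse $y_j=x_j/(1-p(x)^{2c})^{\alpha_j}$, and $\kappa(y)=(1-p(x)^{2c})^{-1}$ for $x=T_{para}(y)$. The vector field governing $x$ in time $\tau$ is $\kappa^{-k}\left(1-\frac{2c-1}{2c}\kappa^{-1}\right)DT_{para}(y)f(y)$ with $y=T_{para}^{-1}(x)$. Explicitly, with $\tilde f_j(x)=\kappa^{-(k+\alpha_j)}f_j(\kappa^{\alpha_1}x_1,\dots,\kappa^{\alpha_n}x_n)$, $\kappa=(1-p(x)^{2c})^{-1}$, it reads $$\frac{dx_i}{d\tau}=\left(1-\frac{2c-1}{2c}(1-p(x)^{2c})\right)\tilde f_i(x)-\alpha_ix_i\sum_{j=1}^n\frac{x_j^{2\beta_j-1}}{\alpha_j}\tilde f_j(x).$$ *)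

theory Defs
  imports "HOL-Analysis.Analysis"
begin

definition quasi_scale :: "('n \<Rightarrow> nat) \<Rightarrow> real \<Rightarrow> real ^ 'n \<Rightarrow> real ^ 'n" where
  "quasi_scale \<alpha> r x = (\<chi> i. r ^ \<alpha> i * x $ i)"

definition homogeneous_of_type :: "('n \<Rightarrow> nat) \<Rightarrow> nat \<Rightarrow> (real ^ 'n \<Rightarrow> real) \<Rightarrow> bool" where
  "homogeneous_of_type \<alpha> m h \<longleftrightarrow> (\<forall>x r. h (quasi_scale \<alpha> r x) = r ^ m * h x)"

text \<open>In the next two definitions the parameter \<open>k\<close> stands for the order \<open>k + 1\<close>.\<close>

definition quasi_homogeneous_field ::
    "('n \<Rightarrow> nat) \<Rightarrow> nat \<Rightarrow> (real ^ 'n \<Rightarrow> real ^ 'n) \<Rightarrow> bool" where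
  "quasi_homogeneous_field \<alpha> k h \<longleftrightarrow>
     (\<forall>j. homogeneous_of_type \<alpha> (k + \<alpha> j) (\<lambda>x. h x $ j))"

definition asymptotically_quasi_homogeneous ::
    "('n::finite \<Rightarrow> nat) \<Rightarrow> nat \<Rightarrow> (real ^ 'n \<Rightarrow> real ^ 'n) \<Rightarrow> bool" where
  "asymptotically_quasi_homogeneous \<alpha> k f \<longleftrightarrow>
     (\<exists>h. quasi_homogeneous_field \<alpha> k h \<and>
       (\<forall>j. uniform_limit (sphere 0 1)
          (\<lambda>r x. inverse (r ^ (k + \<alpha> j)) *
             (f (quasi_scale \<alpha> r x) $ j - r ^ (k + \<alpha> j) * h x $ j))
          (\<lambda>_. 0) at_top))"

definition para_p :: "('n::finite \<Rightarrow> nat) \<Rightarrow> nat \<Rightarrow> real ^ 'n \<Rightarrow> real" where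
  "para_p \<beta> c y = root (2 * c) (\<Sum>i\<in>UNIV. (y $ i) ^ (2 * \<beta> i))"

definition para_disk :: "('n::finite \<Rightarrow> nat) \<Rightarrow> nat \<Rightarrow> (real ^ 'n) set" where
  "para_disk \<beta> c = {x. para_p \<beta> c x < 1}"

definition para_cdisk :: "('n::finite \<Rightarrow> nat) \<Rightarrow> nat \<Rightarrow> (real ^ 'n) set" where
  "para_cdisk \<beta> c = {x. para_p \<beta> c x \<le> 1}"

definition para_kappa :: "('n::finite \<Rightarrow> nat) \<Rightarrow> nat \<Rightarrow> real ^ 'n \<Rightarrow> real" where
  "para_kappa \<beta> c y =
     (if y = 0 then 1
      else (THE \<kappa>. \<kappa> > max 1 (para_p \<beta> c y) \<and>
                   \<kappa> ^ (2 * c) - \<kappa> ^ (2 * c - 1) - para_p \<beta> c y ^ (2 * c) = 0))"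

definition T_para :: "('n::finite \<Rightarrow> nat) \<Rightarrow> ('n \<Rightarrow> nat) \<Rightarrow> nat \<Rightarrow> real ^ 'n \<Rightarrow> real ^ 'n" where
  "T_para \<alpha> \<beta> c y = (\<chi> i. y $ i / para_kappa \<beta> c y ^ \<alpha> i)"

text \<open>The factor \<open>d\<tau>/dt\<close> at the point \<open>y = y(t)\<close>\<close>

definition para_time_rate :: "('n::finite \<Rightarrow> nat) \<Rightarrow> nat \<Rightarrow> nat \<Rightarrow> real ^ 'n \<Rightarrow> real" where
  "para_time_rate \<beta> c k y =
     para_kappa \<beta> c y ^ k *
     inverse (1 - (2 * real c - 1) / (2 * real c) * inverse (para_kappa \<beta> c y))"

text \<open>
  If \<open>y' = f y\<close> and \<open>x = T_para y\<close>, then \<open>dx/dt = DT_para(y) (f y)\<close>, and dividing by \<open>d\<tau>/dt\<close>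
  gives \<open>dx/d\<tau>\<close>.  Only the values on the open set \<open>p < 1\<close>, which is the range of \<open>T_para\<close>,
  are meaningful.
\<close>

definition para_field ::
    "('n::finite \<Rightarrow> nat) \<Rightarrow> ('n \<Rightarrow> nat) \<Rightarrow> nat \<Rightarrow> nat \<Rightarrow> (real ^ 'n \<Rightarrow> real ^ 'n)
      \<Rightarrow> real ^ 'n \<Rightarrow> real ^ 'n" where
  "para_field \<alpha> \<beta> c k f x =
     (let y = inv (T_para \<alpha> \<beta> c) x
      in inverse (para_time_rate \<beta> c k y) *\<^sub>R
           frechet_derivative (T_para \<alpha> \<beta> c) (at y) (f y))"

text \<open>
  A map is \<open>C\<^sup>1\<close> on a set that need not be open if it is there the restriction of a
  continuously differentiable map defined on an open neighbourhood of the set.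
\<close>

definition C1_on :: "'a::real_normed_vector set \<Rightarrow> ('a \<Rightarrow> 'b::real_normed_vector) \<Rightarrow> bool" where
  "C1_on S g \<longleftrightarrow>
     (\<exists>U h h'. open U \<and> S \<subseteq> U \<and> (\<forall>x\<in>S. h x = g x) \<and>
        (\<forall>x\<in>U. (h has_derivative blinfun_apply (h' x)) (at x)) \<and> continuous_on U h')"

end

theory Submission
  imports Defs
begin

text \<open>
  Split a polynomial \<open>f\<^sub>j\<close> into quasi-homogeneous parts,
  \<open>f\<^sub>j (r\<^sup>\<alpha> x) = (\<Sum>d. r\<^sup>d F\<^sub>j\<^sub>,\<^sub>d x)\<close>.  Asymptotic quasi-homogeneity bounds the growth in \<open>r\<close>,
  so only \<open>d \<le> k + \<alpha>\<^sub>j\<close> occurs.  On the disk \<open>\<kappa>\<^sup>-\<^sup>1 = 1 - (\<Sum>i. x\<^sub>i ^ (2 \<beta>\<^sub>i))\<close> is a polynomial in \<open>x\<close>,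
  hence so is each rescaled component \<open>\<kappa> ^ -(k + \<alpha>\<^sub>j) f\<^sub>j (\<kappa>\<^sup>\<alpha> x)\<close>, which contains no positive
  power of \<open>\<kappa>\<close>.  The field in the new time is therefore a polynomial, and extends to the whole space.
\<close>

section \<open>Polynomial functions\<close>

text \<open>If the top degree \<open>N\<close> exceeds \<open>m\<close>, division by
  \<open>r ^ N\<close> isolates the top coefficient in the limit, while the limit \<open>L\<close>
  for division by \<open>r ^ m\<close> makes the same quotient tend to \<open>0 * L\<close>. So the
  top coefficient vanishes, the sum loses its last term, and induction on the degree removes the
  others above \<open>m\<close>.\<close>

lemma polynomial_coeff_zero_above_growth:
  fixes a :: "nat \<Rightarrow> real"
  assumes "((\<lambda>r. inverse (r ^ m) * (\<Sum>i\<le>N. r ^ i * a i)) \<longlongrightarrow> L) at_top"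
    and "m < i" "i \<le> N"
  shows "a i = 0"
  using assms
proof (induction N)
  case 0
  then show ?case by simp
next
  case (Suc n)
  define N where "N = Suc n"
  have "m < N" using Suc.prems unfolding N_def by simp
  have neg_power: "((\<lambda>r::real. inverse (r ^ d)) \<longlongrightarrow> 0) at_top" if "d > 0" for d
    using that by (intro tendsto_inverse_0_at_top filterlim_pow_at_top filterlim_ident)
  have lower: "((\<lambda>r. inverse (r ^ N) * (r ^ j * a j)) \<longlongrightarrow> 0) at_top" if "j \<le> n" for j
  proof (rule Lim_transform_eventually)
    show "((\<lambda>r. inverse (r ^ (N - j)) * a j) \<longlongrightarrow> 0) at_top"
      using tendsto_mult[OF neg_power tendsto_const, of "N - j" "a j"] that by (simp add: N_def)
    show "\<forall>\<^sub>F r in at_top. inverse (r ^ (N - j)) * a j = inverse (r ^ N) * (r ^ j * a j)"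
      using eventually_gt_at_top[of "0::real"]
    proof eventually_elim
      case (elim r)
      have "r ^ N = r ^ (N - j) * r ^ j" using that by (simp add: N_def flip: power_add)
      then show ?case using elim by (simp add: field_simps)
    qed
  qed
  have "((\<lambda>r. (\<Sum>j\<le>n. inverse (r ^ N) * (r ^ j * a j)) + a N) \<longlongrightarrow> (\<Sum>j\<le>n. 0) + a N) at_top"
    by (intro tendsto_intros lower) auto
  moreover have "\<forall>\<^sub>F r in at_top. (\<Sum>j\<le>n. inverse (r ^ N) * (r ^ j * a j)) + a N
      = inverse (r ^ N) * (\<Sum>i\<le>N. r ^ i * a i)"
    using eventually_gt_at_top[of "0::real"]
    by eventually_elim (simp add: N_def distrib_left sum_distrib_left del: power_Suc flip: mult.assoc)
  ultimately have lead: "((\<lambda>r. inverse (r ^ N) * (\<Sum>i\<le>N. r ^ i * a i)) \<longlongrightarrow> a N) at_top"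
    by (simp add: Lim_transform_eventually)
  have "((\<lambda>r. inverse (r ^ (N - m)) * (inverse (r ^ m) * (\<Sum>i\<le>N. r ^ i * a i))) \<longlongrightarrow> 0 * L) at_top"
    using Suc.prems(1) \<open>m < N\<close> unfolding N_def by (intro tendsto_mult neg_power) auto
  moreover have "inverse (r ^ (N - m)) * (inverse (r ^ m) * s) = inverse (r ^ N) * s" for r s :: real
    using \<open>m < N\<close> by (simp flip: mult.assoc inverse_mult_distrib power_add)
  ultimately have "a N = 0"
    using tendsto_unique[OF _ lead] by simp
  then show ?case
    using Suc N_def by (cases "i = N") auto
qed

text \<open>The derivative is built as a bounded linear map by induction on the polynomial, since
  \<open>C1_on\<close> asks for its continuity in the operator norm.\<close>

lemma real_polynomial_function_C1:
  assumes "real_polynomial_function p"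
  shows "\<exists>p'. (\<forall>x. (p has_derivative blinfun_apply (p' x)) (at x)) \<and> continuous_on UNIV p'"
  using assms
proof induction
  case (linear f)
  then show ?case
    by (intro exI[of _ "\<lambda>_. Blinfun f"])
      (auto simp: bounded_linear_Blinfun_apply bounded_linear_imp_has_derivative)
next
  case (const c)
  show ?case by (intro exI[of _ "\<lambda>_. 0"]) (auto simp: zero_blinfun.rep_eq)
next
  case (add f g)
  obtain f' where
    f': "\<And>x. (f has_derivative blinfun_apply (f' x)) (at x)" "continuous_on UNIV f'"
    using add.IH(1) by (elim exE conjE) (rule that; simp)
  obtain g' where
    g': "\<And>x. (g has_derivative blinfun_apply (g' x)) (at x)" "continuous_on UNIV g'"
    using add.IH(2) by (elim exE conjE) (rule that; simp)
  show ?case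
  proof (intro exI[of _ "\<lambda>x. f' x + g' x"] conjI allI)
    show "((\<lambda>x. f x + g x) has_derivative blinfun_apply (f' x + g' x)) (at x)" for x
      unfolding plus_blinfun.rep_eq by (intro has_derivative_add f'(1) g'(1))
    show "continuous_on UNIV (\<lambda>x. f' x + g' x)"
      using f'(2) g'(2) by (intro continuous_intros)
  qed
next
  case (mult f g)
  obtain f' where
    f': "\<And>x. (f has_derivative blinfun_apply (f' x)) (at x)" "continuous_on UNIV f'"
    using mult.IH(1) by (elim exE conjE) (rule that; simp)
  obtain g' where
    g': "\<And>x. (g has_derivative blinfun_apply (g' x)) (at x)" "continuous_on UNIV g'"
    using mult.IH(2) by (elim exE conjE) (rule that; simp)
  have cont: "continuous_on UNIV f" "continuous_on UNIV g"
    by (rule has_derivative_continuous_on, rule f'(1))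
      (rule has_derivative_continuous_on, rule g'(1))
  show ?case
  proof (intro exI[of _ "\<lambda>x. f x *\<^sub>R g' x + g x *\<^sub>R f' x"] conjI allI)
    show "((\<lambda>x. f x * g x) has_derivative blinfun_apply (f x *\<^sub>R g' x + g x *\<^sub>R f' x)) (at x)" for x
      using has_derivative_mult[OF f'(1) g'(1)]
      by (simp add: plus_blinfun.rep_eq scaleR_blinfun.rep_eq mult.commute)
    show "continuous_on UNIV (\<lambda>x. f x *\<^sub>R g' x + g x *\<^sub>R f' x)"
      using f'(2) g'(2) cont by (intro continuous_intros)
  qed
qed

lemma C1_on_real_polynomial_components:
  fixes g :: "'a::real_normed_vector \<Rightarrow> real ^ 'n"
  assumes "\<And>i. real_polynomial_function (\<lambda>x. g x $ i)"
  shows "C1_on S g"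
proof -
  obtain p' where p': "\<And>i x. ((\<lambda>x. g x $ i) has_derivative blinfun_apply (p' i x)) (at x)"
    "\<And>i. continuous_on UNIV (p' i)"
    using real_polynomial_function_C1[OF assms] by metis
  \<comment> \<open>\<open>blinfun_scaleR_left (axis i 1)\<close> sends t to t times the i-th unit
    vector; the sum stacks the component derivatives into one operator and inherits their
    continuity.\<close>
  define g' where "g' x = (\<Sum>i\<in>UNIV. blinfun_scaleR_left (axis i (1::real)) o\<^sub>L p' i x)" for x
  have g: "g = (\<lambda>x. \<Sum>i\<in>UNIV. (g x $ i) *\<^sub>R axis i 1)"
    using basis_expansion[of "g _"] by (simp add: scalar_mult_eq_scaleR)
  have "blinfun_apply (g' x) = (\<lambda>v. \<Sum>i\<in>UNIV. blinfun_apply (p' i x) v *\<^sub>R axis i 1)" for x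
    by (simp add: g'_def blinfun.sum_left fun_eq_iff)
  then have "(g has_derivative blinfun_apply (g' x)) (at x)" for x
    by (subst g) (auto intro!: has_derivative_sum has_derivative_scaleR_left p'(1))
  moreover have "continuous_on UNIV g'"
    unfolding g'_def using p'(2) by (intro continuous_intros)
  ultimately show ?thesis
    unfolding C1_on_def by (intro exI[of _ UNIV] exI[of _ g] exI[of _ g']) auto
qed

section \<open>Decomposition into quasi-homogeneous parts\<close>

lemma quasi_scale_nth [simp]: "quasi_scale \<alpha> r x $ i = r ^ \<alpha> i * x $ i"
  by (simp add: quasi_scale_def)

lemma quasi_scale_quasi_scale: "quasi_scale \<alpha> r (quasi_scale \<alpha> s x) = quasi_scale \<alpha> (r * s) x"
  by (simp add: vec_eq_iff power_mult_distrib)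

lemma quasi_scale_one [simp]: "quasi_scale \<alpha> 1 x = x"
  by (simp add: vec_eq_iff)

lemma real_polynomial_function_nth: "real_polynomial_function (\<lambda>x::real ^ 'n. x $ i)"
  by (intro real_polynomial_function.intros(1) bounded_linear_vec_nth)

text \<open>\<open>F d\<close> collects the monomials of weighted degree \<open>d\<close>,
  coordinate \<open>i\<close> having weight \<open>\<alpha> i\<close>. Linear functionals split by
  weight, products by convolution. Vanishing above \<open>N\<close> lets the induction extend the
  sums to larger ranges.\<close>

lemma real_polynomial_function_quasi_scale_expansion:
  fixes \<alpha> :: "'n::finite \<Rightarrow> nat" and g :: "real ^ 'n \<Rightarrow> real"
  assumes "real_polynomial_function g"
  shows "\<exists>N F. (\<forall>d. real_polynomial_function (F d)) \<and> (\<forall>d>N. F d = (\<lambda>x. 0)) \<and>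
           (\<forall>r x. g (quasi_scale \<alpha> r x) = (\<Sum>d\<le>N. r ^ d * F d x))"
  using assms
proof induction
  case (linear g)
  define N where "N = Max (range \<alpha>)"
  define F where "F d x = (\<Sum>i\<in>UNIV. (if \<alpha> i = d then 1 else 0) * (x $ i * g (axis i 1)))" for d x
  have le: "\<alpha> i \<le> N" for i unfolding N_def by simp
  have "g (quasi_scale \<alpha> r x) = (\<Sum>d\<le>N. r ^ d * F d x)" for r x
  proof -
    interpret g: bounded_linear g by fact
    have "g (quasi_scale \<alpha> r x) = g (\<Sum>i\<in>UNIV. (r ^ \<alpha> i * x $ i) *\<^sub>R axis i 1)"
      using basis_expansion[of "quasi_scale \<alpha> r x"] by (simp add: scalar_mult_eq_scaleR)
    also have "\<dots> = (\<Sum>i\<in>UNIV. r ^ \<alpha> i * x $ i * g (axis i 1))"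
      by (simp add: g.sum g.scaleR)
    also have "\<dots> = (\<Sum>i\<in>UNIV. \<Sum>d\<le>N. if \<alpha> i = d then r ^ d * (x $ i * g (axis i 1)) else 0)"
      using le by (simp add: mult.assoc)
    also have "\<dots> = (\<Sum>d\<le>N. r ^ d * F d x)"
      unfolding F_def sum_distrib_left by (subst sum.swap) (auto intro!: sum.cong)
    finally show ?thesis .
  qed
  moreover have "real_polynomial_function (F d)" for d
    unfolding F_def
    by (intro real_polynomial_function_sum real_polynomial_function.intros(4)
        real_polynomial_function.intros(2) real_polynomial_function_nth) auto
  moreover have "F d = (\<lambda>x. 0)" if "d > N" for d
  proof -
    have "\<alpha> i \<noteq> d" for i using le[of i] that by simp
    then show ?thesis by (simp add: F_def fun_eq_iff)
  qed
  ultimately show ?case by blast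
next
  case (const c)
  show ?case
    by (intro exI[of _ 0] exI[of _ "\<lambda>d x. if d = 0 then c else 0"])
      (auto intro: real_polynomial_function.intros(2))
next
  case (add f g)
  obtain M F where F: "\<And>d. real_polynomial_function (F d)" "\<And>d. d > M \<Longrightarrow> F d = (\<lambda>x. 0)"
      "\<And>r x. f (quasi_scale \<alpha> r x) = (\<Sum>d\<le>M. r ^ d * F d x)"
    using add.IH(1) by blast
  obtain N G where G: "\<And>d. real_polynomial_function (G d)" "\<And>d. d > N \<Longrightarrow> G d = (\<lambda>x. 0)"
      "\<And>r x. g (quasi_scale \<alpha> r x) = (\<Sum>d\<le>N. r ^ d * G d x)"
    using add.IH(2) by blast
  \<comment> \<open>\<open>M + N\<close> bounds both degree ranges, and the terms added by padding
    are zero.\<close>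
  have "f (quasi_scale \<alpha> r x) = (\<Sum>d\<le>M + N. r ^ d * F d x)" for r x
    unfolding F(3) by (rule sum.mono_neutral_left) (auto simp: F(2))
  moreover have "g (quasi_scale \<alpha> r x) = (\<Sum>d\<le>M + N. r ^ d * G d x)" for r x
    unfolding G(3) by (rule sum.mono_neutral_left) (auto simp: G(2))
  ultimately show ?case
    using F(1,2) G(1,2)
    by (intro exI[of _ "M + N"] exI[of _ "\<lambda>d x. F d x + G d x"])
      (auto simp: sum.distrib distrib_left)
next
  case (mult f g)
  obtain M F where F: "\<And>d. real_polynomial_function (F d)" "\<And>d. d > M \<Longrightarrow> F d = (\<lambda>x. 0)"
      "\<And>r x. f (quasi_scale \<alpha> r x) = (\<Sum>d\<le>M. r ^ d * F d x)"
    using mult.IH(1) by blast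
  obtain N G where G: "\<And>d. real_polynomial_function (G d)" "\<And>d. d > N \<Longrightarrow> G d = (\<lambda>x. 0)"
      "\<And>r x. g (quasi_scale \<alpha> r x) = (\<Sum>d\<le>N. r ^ d * G d x)"
    using mult.IH(2) by blast
  define H where "H d x = (\<Sum>k\<le>d. F k x * G (d - k) x)" for d x
  have "f (quasi_scale \<alpha> r x) * g (quasi_scale \<alpha> r x) = (\<Sum>d\<le>M + N. r ^ d * H d x)" for r x
    using polynomial_product[of M "\<lambda>d. F d x" N "\<lambda>d. G d x" r]
    by (simp add: F G H_def mult.commute)
  moreover have "real_polynomial_function (H d)" for d
    unfolding H_def using F(1) G(1)
    by (intro real_polynomial_function_sum real_polynomial_function.intros(4)) auto
  moreover have "H d = (\<lambda>x. 0)" if "d > M + N" for d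
  proof -
    \<comment> \<open>Either \<open>k > M\<close>, or \<open>d > M + N\<close> forces
      \<open>d - k > N\<close>; one factor vanishes in each case.\<close>
    have "F k x * G (d - k) x = 0" if "k \<le> d" for k x
      using F(2)[of k] G(2)[of "d - k"] \<open>d > M + N\<close> by (cases "k > M") auto
    then show ?thesis by (auto simp: H_def fun_eq_iff intro!: sum.neutral)
  qed
  ultimately show ?case by blast
qed

text \<open>Intermediate value theorem along the orbit of \<open>x\<close>: the norm is 0 at
  \<open>s = 0\<close> and at least 1 for a large \<open>s\<close>.\<close>

lemma quasi_scale_meets_sphere:
  fixes x :: "real ^ 'n::finite"
  assumes "\<And>i. \<alpha> i \<ge> 1" and "x \<noteq> 0"
  shows "\<exists>s>0. quasi_scale \<alpha> s x \<in> sphere 0 1"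
proof -
  obtain i where i: "x $ i \<noteq> 0" using assms(2) by (auto simp: vec_eq_iff)
  \<comment> \<open>With \<open>R \<ge> 1\<close> and positive weight,
    \<open>R \<le> R ^ \<alpha> i\<close>; the second entry of the maximum then makes coordinate
    \<open>i\<close> alone push the norm to at least 1.\<close>
  define R where "R = max 1 (1 / \<bar>x $ i\<bar>)"
  have "R \<ge> 1" unfolding R_def by simp
  have cont: "continuous_on A (\<lambda>s. norm (quasi_scale \<alpha> s x))" for A
    unfolding quasi_scale_def by (intro continuous_intros)
  have zero: "quasi_scale \<alpha> 0 x = 0"
  proof -
    \<comment> \<open>Positive weights matter here, because \<open>0 ^ 0 = 1\<close>.\<close>
    have "(0::real) ^ \<alpha> i = 0" for i using assms(1)[of i] by (simp add: power_0_left)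
    then show ?thesis by (simp add: vec_eq_iff)
  qed
  have "R * \<bar>x $ i\<bar> \<ge> 1"
    using i unfolding R_def by (simp add: max_def field_simps)
  moreover have "R \<le> R ^ \<alpha> i"
    using \<open>R \<ge> 1\<close> assms(1)[of i] by (simp add: self_le_power)
  ultimately have "1 \<le> R ^ \<alpha> i * \<bar>x $ i\<bar>"
    by (smt (verit) mult_right_mono abs_ge_zero)
  also have "\<dots> = \<bar>quasi_scale \<alpha> R x $ i\<bar>"
    using \<open>R \<ge> 1\<close> by (simp add: abs_mult)
  also have "\<dots> \<le> norm (quasi_scale \<alpha> R x)" by (rule component_le_norm_cart)
  finally obtain s where "0 \<le> s" "norm (quasi_scale \<alpha> s x) = 1"
    using IVT'[of "\<lambda>s. norm (quasi_scale \<alpha> s x)" 0 1 R] cont zero \<open>R \<ge> 1\<close> by auto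
  moreover have "s \<noteq> 0" using calculation zero by auto
  ultimately show ?thesis by (intro exI[of _ s]) auto
qed

text \<open>The hypothesis controls the growth of \<open>f\<close> along orbits of points of the
  unit sphere. Every nonzero \<open>x\<close> lies on such an orbit, so the quotient by
  \<open>r ^ (k + \<alpha> j)\<close> converges for each fixed \<open>x\<close>, and no higher power
  of \<open>r\<close> can occur.\<close>

lemma asymptotically_quasi_homogeneous_expansion:
  fixes f :: "real ^ 'n::finite \<Rightarrow> real ^ 'n"
  assumes "\<And>i. \<alpha> i \<ge> 1" and "polynomial_function f"
    and "asymptotically_quasi_homogeneous \<alpha> k f"
  shows "\<exists>F. (\<forall>d. real_polynomial_function (F d)) \<and>
    (\<forall>r x. f (quasi_scale \<alpha> r x) $ j = (\<Sum>d\<le>k + \<alpha> j. r ^ d * F d x))"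
proof -
  define m where "m = k + \<alpha> j"
  have "real_polynomial_function (\<lambda>x. f x $ j)"
    using assms(2) bounded_linear_vec_nth[of j] unfolding polynomial_function_def o_def by blast
  from real_polynomial_function_quasi_scale_expansion[OF this, of \<alpha>]
  obtain N F where F: "\<And>d. real_polynomial_function (F d)" "\<And>d. d > N \<Longrightarrow> F d = (\<lambda>x. 0)"
      "\<And>r x. f (quasi_scale \<alpha> r x) $ j = (\<Sum>d\<le>N. r ^ d * F d x)"
    by blast
  obtain h where h: "uniform_limit (sphere 0 1) (\<lambda>r x. inverse (r ^ m) *
             (f (quasi_scale \<alpha> r x) $ j - r ^ m * h x $ j)) (\<lambda>_. 0) at_top"
    using assms(3) unfolding asymptotically_quasi_homogeneous_def m_def by blast
  have sphere: "((\<lambda>r. inverse (r ^ m) * f (quasi_scale \<alpha> r x) $ j) \<longlongrightarrow> h x $ j) at_top"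
    if "x \<in> sphere 0 1" for x
  proof -
    have "((\<lambda>r. inverse (r ^ m) * (f (quasi_scale \<alpha> r x) $ j - r ^ m * h x $ j) + h x $ j)
        \<longlongrightarrow> 0 + h x $ j) at_top"
      by (intro tendsto_add tendsto_const tendsto_uniform_limitI[OF h] that)
    moreover have "\<forall>\<^sub>F r in at_top. inverse (r ^ m) * (f (quasi_scale \<alpha> r x) $ j - r ^ m * h x $ j) + h x $ j
        = inverse (r ^ m) * f (quasi_scale \<alpha> r x) $ j"
      using eventually_gt_at_top[of 0] by eventually_elim (simp add: field_simps)
    ultimately show ?thesis
      by (simp add: Lim_transform_eventually)
  qed
  have "\<exists>L. ((\<lambda>r. inverse (r ^ m) * f (quasi_scale \<alpha> r x) $ j) \<longlongrightarrow> L) at_top" for x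
  proof (cases "x = 0")
    case True
    \<comment> \<open>The orbit of the origin is constant, and the quotient tends to 0 because
      \<open>m \<ge> \<alpha> j \<ge> 1\<close>.\<close>
    have "quasi_scale \<alpha> r 0 = 0" for r by (simp add: vec_eq_iff)
    moreover have "((\<lambda>r::real. inverse (r ^ m)) \<longlongrightarrow> 0) at_top"
      using assms(1)[of j] unfolding m_def
      by (intro tendsto_inverse_0_at_top filterlim_pow_at_top filterlim_ident) auto
    then have "((\<lambda>r. inverse (r ^ m) * f 0 $ j) \<longlongrightarrow> 0 * f 0 $ j) at_top"
      by (intro tendsto_mult tendsto_const)
    ultimately show ?thesis
      using True by (intro exI[of _ "0 * f 0 $ j"]) simp
  next
    case False
    have "\<exists>s>0. quasi_scale \<alpha> s x \<in> sphere 0 1"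
      by (rule quasi_scale_meets_sphere) (fact assms(1) False)+
    then obtain s where "s > 0" and s: "quasi_scale \<alpha> s x \<in> sphere 0 1"
      by (elim exE conjE)
    define y where "y = quasi_scale \<alpha> s x"
    \<comment> \<open>Reparametrise the orbit: scaling \<open>x\<close> by \<open>r\<close> is
      scaling the sphere point \<open>y\<close> by \<open>r / s\<close>, at the cost of the constant
      factor \<open>inverse (s ^ m)\<close>.\<close>
    have "filterlim (\<lambda>r. inverse s * r) at_top at_top"
      using \<open>s > 0\<close> by (intro filterlim_tendsto_pos_mult_at_top[OF tendsto_const] filterlim_ident) auto
    from filterlim_compose[OF sphere[OF s] this]
    have "((\<lambda>r. inverse (s ^ m) * (inverse ((inverse s * r) ^ m) * f (quasi_scale \<alpha> (inverse s * r) y) $ j))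
        \<longlongrightarrow> inverse (s ^ m) * h y $ j) at_top"
      unfolding y_def by (intro tendsto_mult tendsto_const)
    moreover have "inverse (s ^ m) * (inverse ((inverse s * r) ^ m) * f (quasi_scale \<alpha> (inverse s * r) y) $ j)
        = inverse (r ^ m) * f (quasi_scale \<alpha> r x) $ j" for r
      using \<open>s > 0\<close> by (simp add: y_def quasi_scale_quasi_scale power_mult_distrib field_simps)
    ultimately show ?thesis by auto
  qed
  then have "\<exists>L. ((\<lambda>r. inverse (r ^ m) * (\<Sum>d\<le>N. r ^ d * F d x)) \<longlongrightarrow> L) at_top" for x
    unfolding F(3) .
  then have high: "F d x = 0" if "m < d" "d \<le> N" for d x
    using polynomial_coeff_zero_above_growth[where a = "\<lambda>i. F i x", OF _ that] by metis
  \<comment> \<open>\<open>N\<close> and \<open>m\<close> may come in either order, so the terms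
    outside the common range are shown to vanish on both sides.\<close>
  have "f (quasi_scale \<alpha> r x) $ j = (\<Sum>d\<le>m. r ^ d * F d x)" for r x
    unfolding F(3)
  proof (rule sum.mono_neutral_cong)
    show "r ^ d * F d x = 0" if "d \<in> {..m} - {..N}" for d
      using that F(2)[of d] by simp
    show "r ^ d * F d x = 0" if "d \<in> {..N} - {..m}" for d
      using that high[of d x] by simp
  qed simp_all
  then show ?thesis using F(1) m_def by blast
qed

section \<open>The quasi-parabolic compactification\<close>

text \<open>This is p^(2c). Using it in place of \<open>para_p\<close> removes the root and keeps
  every formula polynomial.\<close>

definition para_sum :: "('n::finite \<Rightarrow> nat) \<Rightarrow> real ^ 'n \<Rightarrow> real" where
  "para_sum \<beta> x = (\<Sum>i\<in>UNIV. (x $ i) ^ (2 * \<beta> i))"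

text \<open>Divided by \<open>2 * c\<close>, the coefficient of \<open>u $ j\<close> becomes
  \<open>(x $ j) ^ (2 * \<beta> j - 1) / \<alpha> j\<close>, by
  \<open>\<alpha> j * \<beta> j = c\<close>; this is the sum in the explicit form of the
  field.\<close>

definition para_sum_deriv :: "('n::finite \<Rightarrow> nat) \<Rightarrow> real ^ 'n \<Rightarrow> real ^ 'n \<Rightarrow> real" where
  "para_sum_deriv \<beta> x u = (\<Sum>j\<in>UNIV. 2 * real (\<beta> j) * (x $ j) ^ (2 * \<beta> j - 1) * u $ j)"

lemma para_sum_nonneg: "para_sum \<beta> x \<ge> 0"
  unfolding para_sum_def by (intro sum_nonneg) simp

lemma has_derivative_para_sum: "(para_sum \<beta> has_derivative para_sum_deriv \<beta> x) (at x)"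
  unfolding para_sum_def[abs_def] para_sum_deriv_def[abs_def]
  by (auto intro!: derivative_eq_intros bounded_linear_imp_has_derivative simp: mult_ac)

lemma para_sum_deriv_scaleR: "para_sum_deriv \<beta> x (t *\<^sub>R u) = t * para_sum_deriv \<beta> x u"
  by (simp add: para_sum_deriv_def sum_distrib_left mult_ac)

lemma para_sum_deriv_diff:
  "para_sum_deriv \<beta> x (u - v) = para_sum_deriv \<beta> x u - para_sum_deriv \<beta> x v"
  by (simp add: para_sum_deriv_def sum_subtractf algebra_simps)

lemma real_polynomial_function_para_sum: "real_polynomial_function (para_sum \<beta>)"
  unfolding para_sum_def[abs_def]
  by (intro real_polynomial_function_sum real_polynomial_function_power
      real_polynomial_function_nth) simp

locale quasi_parabolic =
  fixes \<alpha> \<beta> :: "'n::finite \<Rightarrow> nat" and c :: nat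
  assumes alpha_pos: "\<alpha> i \<ge> 1" and beta_pos: "\<beta> i \<ge> 1" and c_pos: "c \<ge> 1"
    and alpha_beta: "\<alpha> i * \<beta> i = c"
begin

lemma para_p_power: "para_p \<beta> c x ^ (2 * c) = para_sum \<beta> x"
  using c_pos para_sum_nonneg[of \<beta> x] by (simp add: para_p_def para_sum_def real_root_pow_pos2)

lemma mem_para_disk_iff: "x \<in> para_disk \<beta> c \<longleftrightarrow> para_sum \<beta> x < 1"
  using c_pos by (simp add: para_disk_def para_p_def para_sum_def)

lemma open_para_disk: "open (para_disk \<beta> c)"
proof -
  have "para_disk \<beta> c = {x. para_sum \<beta> x < 1}" by (auto simp: mem_para_disk_iff)
  then show ?thesis unfolding para_sum_def by (auto intro!: open_Collect_less continuous_intros)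
qed

text \<open>The relation between the weights and the exponents gives all summands the same order,
  \<open>\<alpha> i * (2 * \<beta> i) = 2 * c\<close>.\<close>

lemma para_sum_quasi_scale: "para_sum \<beta> (quasi_scale \<alpha> r x) = r ^ (2 * c) * para_sum \<beta> x"
proof -
  have "(r ^ \<alpha> i * x $ i) ^ (2 * \<beta> i) = r ^ (2 * c) * (x $ i) ^ (2 * \<beta> i)" for i
  proof -
    have "\<alpha> i * (2 * \<beta> i) = 2 * c" using alpha_beta[of i] by simp
    then have "(r ^ \<alpha> i) ^ (2 * \<beta> i) = r ^ (2 * c)" by (metis power_mult)
    then show ?thesis by (simp add: power_mult_distrib)
  qed
  then show ?thesis by (simp add: para_sum_def sum_distrib_left)
qed

lemma para_sum_eq_0_iff: "para_sum \<beta> x = 0 \<longleftrightarrow> x = 0"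
proof -
  have "\<beta> i \<noteq> 0" for i using beta_pos[of i] by simp
  then show ?thesis
    unfolding para_sum_def by (subst sum_nonneg_eq_0_iff) (auto simp: vec_eq_iff)
qed

section \<open>The equation defining kappa\<close>

lemma kappa_equation_strict_mono:
  fixes s t :: real
  assumes "1 \<le> s" "s < t"
  shows "s ^ m * (s - 1) < t ^ m * (t - 1)"
proof -
  have "s ^ m * (s - 1) \<le> t ^ m * (s - 1)"
    using assms by (intro mult_right_mono power_mono) auto
  also have "\<dots> < t ^ m * (t - 1)" using assms by simp
  finally show ?thesis .
qed

text \<open>Handles the origin and the unique-choice case together. For nonzero \<open>y\<close> the
  equation forces \<open>\<kappa> > 1\<close>, and then \<open>\<kappa> ^ (2 * c)\<close> exceeds
  p^(2c), which gives the bound \<open>\<kappa> > max 1 p\<close>. Uniqueness is strict monotonicity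
  on \<open>\<kappa> \<ge> 1\<close>.\<close>

lemma para_kappa_eqI:
  assumes "\<kappa> \<ge> 1" and eq: "\<kappa> ^ (2 * c - 1) * (\<kappa> - 1) = para_sum \<beta> y"
  shows "para_kappa \<beta> c y = \<kappa>"
proof (cases "y = 0")
  case True
  then have "\<kappa> ^ (2 * c - 1) * (\<kappa> - 1) = 0" using eq para_sum_eq_0_iff by simp
  then have "\<kappa> = 1" using assms(1) by auto
  then show ?thesis using True by (simp add: para_kappa_def)
next
  case False
  have pow: "t ^ (2 * c) - t ^ (2 * c - 1) = t ^ (2 * c - 1) * (t - 1)" for t :: real
    using c_pos power_Suc[of t "2 * c - 1"] by (simp add: algebra_simps)
  have "para_sum \<beta> y > 0" using False para_sum_nonneg[of \<beta> y] para_sum_eq_0_iff[of y] by linarith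
  then have "\<kappa> > 1" using assms by (cases "\<kappa> = 1") auto
  have "\<kappa> ^ (2 * c - 1) > 0" using \<open>\<kappa> > 1\<close> by simp
  then have "para_p \<beta> c y ^ (2 * c) < \<kappa> ^ (2 * c)"
    using pow[of \<kappa>] eq unfolding para_p_power by linarith
  then have "para_p \<beta> c y < \<kappa>" using \<open>\<kappa> > 1\<close> power_less_imp_less_base by fastforce
  have "(THE \<kappa>. \<kappa> > max 1 (para_p \<beta> c y) \<and>
                   \<kappa> ^ (2 * c) - \<kappa> ^ (2 * c - 1) - para_p \<beta> c y ^ (2 * c) = 0) = \<kappa>"
  proof (rule the_equality)
    show "\<kappa> > max 1 (para_p \<beta> c y) \<and> \<kappa> ^ (2 * c) - \<kappa> ^ (2 * c - 1) - para_p \<beta> c y ^ (2 * c) = 0"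
      using \<open>\<kappa> > 1\<close> \<open>para_p \<beta> c y < \<kappa>\<close> eq unfolding para_p_power pow by simp
  next
    fix t assume "t > max 1 (para_p \<beta> c y) \<and> t ^ (2 * c) - t ^ (2 * c - 1) - para_p \<beta> c y ^ (2 * c) = 0"
    then have "t > 1" "t ^ (2 * c - 1) * (t - 1) = \<kappa> ^ (2 * c - 1) * (\<kappa> - 1)"
      using eq unfolding para_p_power pow by auto
    then show "t = \<kappa>"
      using kappa_equation_strict_mono[of t \<kappa> "2 * c - 1"] kappa_equation_strict_mono[of \<kappa> t "2 * c - 1"]
        assms(1) by (cases t \<kappa> rule: linorder_cases) auto
  qed
  then show ?thesis using False by (simp add: para_kappa_def)
qed

lemma para_kappa:
  shows para_kappa_ge_1: "para_kappa \<beta> c y \<ge> 1"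
    and para_kappa_equation:
      "para_kappa \<beta> c y ^ (2 * c - 1) * (para_kappa \<beta> c y - 1) = para_sum \<beta> y"
proof -
  define P where "P = para_sum \<beta> y"
  have "P \<ge> 0" unfolding P_def by (rule para_sum_nonneg)
  \<comment> \<open>At \<open>t = 1 + P\<close> the left side of the equation is already at least
    \<open>P\<close>, so a root lies between 1 and \<open>1 + P\<close>.\<close>
  have "1 * P \<le> (1 + P) ^ (2 * c - 1) * P"
    using \<open>P \<ge> 0\<close> by (intro mult_right_mono one_le_power) auto
  moreover have "continuous_on {1..1 + P} (\<lambda>t. t ^ (2 * c - 1) * (t - 1))"
    by (intro continuous_intros)
  ultimately obtain t where "1 \<le> t" "t ^ (2 * c - 1) * (t - 1) = P"
    using IVT'[of "\<lambda>t. t ^ (2 * c - 1) * (t - 1)" 1 P "1 + P"] \<open>P \<ge> 0\<close> by auto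
  then show "para_kappa \<beta> c y \<ge> 1"
    "para_kappa \<beta> c y ^ (2 * c - 1) * (para_kappa \<beta> c y - 1) = para_sum \<beta> y"
    using para_kappa_eqI[of t y] by (simp_all add: P_def)
qed

section \<open>The inverse of the compactification\<close>

lemma T_para_eq: "T_para \<alpha> \<beta> c y = quasi_scale \<alpha> (inverse (para_kappa \<beta> c y)) y"
  by (simp add: T_para_def vec_eq_iff divide_inverse power_inverse)

definition T_para_inv :: "real ^ 'n \<Rightarrow> real ^ 'n" where
  "T_para_inv x = quasi_scale \<alpha> (inverse (1 - para_sum \<beta> x)) x"

text \<open>Homogeneity and the equation for kappa give p^(2c) = (kappa - 1) / kappa at the image
  point, so \<open>T_para_inv\<close> rescales by exactly kappa.\<close>

lemma T_para_inv_T_para: "T_para_inv (T_para \<alpha> \<beta> c y) = y"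
proof -
  define \<kappa> where "\<kappa> = para_kappa \<beta> c y"
  have "\<kappa> \<ge> 1" and eq: "\<kappa> ^ (2 * c - 1) * (\<kappa> - 1) = para_sum \<beta> y"
    using para_kappa by (auto simp: \<kappa>_def)
  have "\<kappa> ^ (2 * c) = \<kappa> * \<kappa> ^ (2 * c - 1)"
    using c_pos power_Suc[of \<kappa> "2 * c - 1"] by simp
  then have "para_sum \<beta> (T_para \<alpha> \<beta> c y) = (\<kappa> - 1) / \<kappa>"
    using \<open>\<kappa> \<ge> 1\<close>
    by (simp add: T_para_eq para_sum_quasi_scale flip: \<kappa>_def eq) (simp add: field_simps)
  moreover have "1 - (\<kappa> - 1) / \<kappa> = inverse \<kappa>" using \<open>\<kappa> \<ge> 1\<close> by (simp add: field_simps)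
  ultimately have "inverse (1 - para_sum \<beta> (T_para \<alpha> \<beta> c y)) = \<kappa>" by simp
  then show ?thesis
    using \<open>\<kappa> \<ge> 1\<close> unfolding T_para_inv_def
    by (simp add: T_para_eq quasi_scale_quasi_scale flip: \<kappa>_def)
qed

lemma para_kappa_T_para_inv:
  assumes "x \<in> para_disk \<beta> c"
  shows "para_kappa \<beta> c (T_para_inv x) = inverse (1 - para_sum \<beta> x)"
proof (rule para_kappa_eqI)
  define \<kappa> where "\<kappa> = inverse (1 - para_sum \<beta> x)"
  have P: "0 \<le> para_sum \<beta> x" "para_sum \<beta> x < 1"
    using assms by (auto simp: mem_para_disk_iff para_sum_nonneg)
  show "1 \<le> inverse (1 - para_sum \<beta> x)"
    using P by (simp add: one_le_inverse)
  have "\<kappa> - 1 = \<kappa> * para_sum \<beta> x"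
    using P by (simp add: \<kappa>_def field_simps)
  moreover have "\<kappa> ^ (2 * c) = \<kappa> ^ (2 * c - 1) * \<kappa>"
    using c_pos power_Suc2[of \<kappa> "2 * c - 1"] by simp
  ultimately show "inverse (1 - para_sum \<beta> x) ^ (2 * c - 1) * (inverse (1 - para_sum \<beta> x) - 1)
      = para_sum \<beta> (T_para_inv x)"
    by (simp add: T_para_inv_def para_sum_quasi_scale flip: \<kappa>_def)
qed

lemma T_para_T_para_inv:
  assumes "x \<in> para_disk \<beta> c"
  shows "T_para \<alpha> \<beta> c (T_para_inv x) = x"
proof -
  have "para_sum \<beta> x \<noteq> 1" using assms by (simp add: mem_para_disk_iff)
  then show ?thesis
    unfolding T_para_eq para_kappa_T_para_inv[OF assms]
    by (simp add: T_para_inv_def quasi_scale_quasi_scale)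
qed

text \<open>\<open>inv\<close> is a choice function; injectivity on the whole space and the preimage
  \<open>T_para_inv x\<close> pin it down on the disk.\<close>

lemma inv_T_para:
  assumes "x \<in> para_disk \<beta> c"
  shows "inv (T_para \<alpha> \<beta> c) x = T_para_inv x"
proof (rule inv_f_eq)
  show "inj (T_para \<alpha> \<beta> c)" using T_para_inv_T_para by (rule inj_on_inverseI)
qed (rule T_para_T_para_inv[OF assms])

section \<open>Derivatives of the compactification and its inverse\<close>

lemma has_derivative_T_para_inv:
  assumes "x \<in> para_disk \<beta> c"
  defines "\<kappa> \<equiv> inverse (1 - para_sum \<beta> x)"
  shows "(T_para_inv has_derivative
    (\<lambda>u. \<chi> i. \<kappa> ^ \<alpha> i * (u $ i + real (\<alpha> i) * \<kappa> * para_sum_deriv \<beta> x u * x $ i))) (at x)"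
proof -
  have P: "1 - para_sum \<beta> x \<noteq> 0" using assms(1) by (simp add: mem_para_disk_iff)
  have \<kappa>: "((\<lambda>x. inverse (1 - para_sum \<beta> x)) has_derivative
      (\<lambda>u. \<kappa> ^ 2 * para_sum_deriv \<beta> x u)) (at x)"
    using P by (auto intro!: derivative_eq_intros has_derivative_para_sum
        simp: \<kappa>_def power2_eq_square mult_ac)
  have "((\<lambda>x. inverse (1 - para_sum \<beta> x) ^ \<alpha> i * x $ i) has_derivative
      (\<lambda>u. \<kappa> ^ \<alpha> i * (u $ i + real (\<alpha> i) * \<kappa> * para_sum_deriv \<beta> x u * x $ i))) (at x)" for i
  proof -
    \<comment> \<open>The power rule leaves
      \<open>\<kappa> ^ (\<alpha> i - 1) * \<kappa> ^ 2\<close>; positivity of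
      \<open>\<alpha> i\<close> turns this into
      \<open>\<kappa> ^ \<alpha> i * \<kappa>\<close>.\<close>
    have "\<kappa> ^ \<alpha> i = \<kappa> ^ (\<alpha> i - 1) * \<kappa>"
      using alpha_pos[of i] power_Suc2[of \<kappa> "\<alpha> i - 1"] by simp
    then show ?thesis
      by (intro has_derivative_eq_rhs[OF has_derivative_mult[OF has_derivative_power[OF \<kappa>]
              bounded_linear_imp_has_derivative[OF bounded_linear_vec_nth]]])
        (simp add: fun_eq_iff power2_eq_square algebra_simps flip: \<kappa>_def)
  qed
  then show ?thesis
    by (subst has_derivative_componentwise_within)
      (auto simp: Basis_vec_def inner_axis T_para_inv_def)
qed

text \<open>
  Obtained from the inverse function theorem, so that \<open>para_kappa\<close> need not be differentiated.
\<close>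

lemma has_derivative_T_para:
  assumes "x \<in> para_disk \<beta> c"
  defines "\<kappa> \<equiv> inverse (1 - para_sum \<beta> x)"
  shows "(T_para \<alpha> \<beta> c has_derivative
    (\<lambda>v. let w = quasi_scale \<alpha> (inverse \<kappa>) v in
      \<chi> i. w $ i - real (\<alpha> i) * x $ i * \<kappa> * para_sum_deriv \<beta> x w / (1 + 2 * real c * (\<kappa> - 1))))
    (at (T_para_inv x))"
    (is "(_ has_derivative ?T') _")
proof (rule has_derivative_inverse_strong[OF open_para_disk assms(1)])
  show "continuous_on (para_disk \<beta> c) T_para_inv"
    by (intro continuous_at_imp_continuous_on ballI)
      (rule has_derivative_continuous[OF has_derivative_T_para_inv])
  show "(T_para_inv has_derivative
    (\<lambda>u. \<chi> i. \<kappa> ^ \<alpha> i * (u $ i + real (\<alpha> i) * \<kappa> * para_sum_deriv \<beta> x u * x $ i))) (at x)"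
    (is "(_ has_derivative ?D) _")
    unfolding \<kappa>_def by (rule has_derivative_T_para_inv[OF assms(1)])
  have P: "0 \<le> para_sum \<beta> x" "para_sum \<beta> x < 1"
    using assms(1) by (auto simp: mem_para_disk_iff para_sum_nonneg)
  have "\<kappa> \<ge> 1" unfolding \<kappa>_def using P by (simp add: one_le_inverse)
  have \<kappa>P: "\<kappa> * para_sum \<beta> x = \<kappa> - 1" using P by (simp add: \<kappa>_def field_simps)
  \<comment> \<open>Up to diagonal scaling, \<open>?D\<close> is the identity plus a rank-one map,
    and \<open>A\<close> is the determinant \<open>1 + \<kappa> * para_sum_deriv \<beta> x (\<chi>
    i. real (\<alpha> i) * x $ i)\<close> of that perturbation, evaluated by Euler's identity and
    \<open>\<kappa>P\<close>.\<close>
  define A where "A = 1 + 2 * real c * (\<kappa> - 1)"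
  have "A > 0" unfolding A_def using \<open>\<kappa> \<ge> 1\<close> by (intro add_pos_nonneg) auto
  \<comment> \<open>Euler's identity for the quasi-homogeneous function \<open>para_sum \<beta>\<close>\<close>
  have euler: "para_sum_deriv \<beta> x (\<chi> i. real (\<alpha> i) * x $ i) = 2 * real c * para_sum \<beta> x"
  proof -
    have "2 * real (\<beta> j) * (x $ j) ^ (2 * \<beta> j - 1) * (real (\<alpha> j) * x $ j)
        = 2 * real c * (x $ j) ^ (2 * \<beta> j)" for j
      using power_Suc2[of "x $ j" "2 * \<beta> j - 1"] beta_pos[of j]
      by (simp add: alpha_beta[of j, symmetric])
    then show ?thesis
      unfolding para_sum_deriv_def para_sum_def vec_lambda_beta sum_distrib_left
      by (rule sum.cong[OF refl])
  qed
  have "?D (?T' v) = v" for v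
  proof -
    define w where "w = quasi_scale \<alpha> (inverse \<kappa>) v"
    define q where "q = para_sum_deriv \<beta> x w"
    \<comment> \<open>The Sherman-Morrison solution of the rank-one perturbed system with right-hand
      side \<open>w\<close>.\<close>
    define z where "z = w - (\<kappa> * q / A) *\<^sub>R (\<chi> i. real (\<alpha> i) * x $ i)"
    have "?T' v = z"
      by (simp add: z_def Let_def vec_eq_iff flip: w_def q_def A_def)
    moreover have "para_sum_deriv \<beta> x z = q / A"
    proof -
      have "q - \<kappa> * q / A * (2 * real c * para_sum \<beta> x) = q - q * (2 * real c * (\<kappa> - 1)) / A"
        by (simp flip: \<kappa>P)
      also have "\<dots> = q / A" using \<open>A > 0\<close> by (simp add: field_simps) (simp add: A_def algebra_simps)
      finally show ?thesis
        by (simp add: z_def para_sum_deriv_diff para_sum_deriv_scaleR euler flip: q_def)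
    qed
    moreover have "\<kappa> ^ \<alpha> i * w $ i = v $ i" for i
      using \<open>\<kappa> \<ge> 1\<close> by (simp add: w_def flip: mult.assoc power_mult_distrib)
    ultimately show ?thesis by (simp add: vec_eq_iff) (simp add: z_def)
  qed
  then show "?D \<circ> ?T' = id" by (simp only: fun_eq_iff o_def id_def simp_thms)
qed (rule T_para_T_para_inv)

section \<open>The field in the new time variable\<close>

text \<open>\<open>G\<close> is the rescaled field, written in powers of 1/kappa = 1 - p^(2c). The
  derivative of \<open>T_para\<close> contributes \<open>\<kappa> ^ k\<close> and a denominator
  \<open>A\<close>; the time change cancels both, leaving an expression without kappa.\<close>

lemma para_field_eq:
  assumes "x \<in> para_disk \<beta> c"
    and f: "\<And>r j. f (quasi_scale \<alpha> r x) $ j = (\<Sum>d\<le>k + \<alpha> j. r ^ d * F j d x)"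
  defines "G \<equiv> \<chi> j. \<Sum>d\<le>k + \<alpha> j. (1 - para_sum \<beta> x) ^ (k + \<alpha> j - d) * F j d x"
  shows "para_field \<alpha> \<beta> c k f x $ i =
    (1 - (2 * real c - 1) / (2 * real c) * (1 - para_sum \<beta> x)) * G $ i
      - real (\<alpha> i) * x $ i * (para_sum_deriv \<beta> x G / (2 * real c))"
proof -
  define \<kappa> where "\<kappa> = inverse (1 - para_sum \<beta> x)"
  define A where "A = 1 + 2 * real c * (\<kappa> - 1)"
  define q where "q = para_sum_deriv \<beta> x G"
  have P: "0 \<le> para_sum \<beta> x" "para_sum \<beta> x < 1"
    using assms(1) by (auto simp: mem_para_disk_iff para_sum_nonneg)
  have "\<kappa> \<ge> 1" unfolding \<kappa>_def using P by (simp add: one_le_inverse)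
  then have "\<kappa> \<noteq> 0" by simp
  have inv_\<kappa>: "1 - para_sum \<beta> x = inverse \<kappa>" by (simp add: \<kappa>_def)
  have "A > 0" unfolding A_def using \<open>\<kappa> \<ge> 1\<close> by (intro add_pos_nonneg) auto
  have "c > 0" using c_pos by simp
  have "quasi_scale \<alpha> (inverse \<kappa>) (f (T_para_inv x)) = \<kappa> ^ k *\<^sub>R G"
  proof -
    \<comment> \<open>The degree bound \<open>d \<le> k + \<alpha> j\<close> makes the
      natural-number subtraction exact, so only nonnegative powers of
      \<open>inverse \<kappa>\<close> remain.\<close>
    have "inverse \<kappa> ^ \<alpha> j * (\<kappa> ^ d * F j d x) = \<kappa> ^ k * (inverse \<kappa> ^ (k + \<alpha> j - d) * F j d x)"
      if "d \<le> k + \<alpha> j" for j d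
    proof -
      have "\<kappa> ^ d * \<kappa> ^ (k + \<alpha> j - d) = \<kappa> ^ k * \<kappa> ^ \<alpha> j" using that by (simp flip: power_add)
      then show ?thesis using \<open>\<kappa> \<noteq> 0\<close> by (simp add: field_simps power_inverse)
    qed
    then have "(\<Sum>d\<le>k + \<alpha> j. inverse \<kappa> ^ \<alpha> j * (\<kappa> ^ d * F j d x))
        = (\<Sum>d\<le>k + \<alpha> j. \<kappa> ^ k * (inverse \<kappa> ^ (k + \<alpha> j - d) * F j d x))" for j
      by (intro sum.cong) auto
    then show ?thesis
      unfolding T_para_inv_def
      by (simp add: vec_eq_iff f G_def sum_distrib_left inv_\<kappa>)
  qed
  then have "frechet_derivative (T_para \<alpha> \<beta> c) (at (T_para_inv x)) (f (T_para_inv x)) $ i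
      = \<kappa> ^ k * (G $ i - real (\<alpha> i) * x $ i * \<kappa> * q / A)"
    unfolding frechet_derivative_at[OF has_derivative_T_para[OF assms(1)], symmetric]
    by (simp add: Let_def para_sum_deriv_scaleR flip: \<kappa>_def A_def q_def)
      (simp add: right_diff_distrib mult.left_commute)
  moreover have "inverse (para_time_rate \<beta> c k (T_para_inv x))
      = inverse (\<kappa> ^ k) * (1 - (2 * real c - 1) / (2 * real c) * inverse \<kappa>)"
    unfolding para_time_rate_def para_kappa_T_para_inv[OF assms(1)] by (simp add: \<kappa>_def)
  ultimately have "para_field \<alpha> \<beta> c k f x $ i = (1 - (2 * real c - 1) / (2 * real c) * inverse \<kappa>)
      * (G $ i - real (\<alpha> i) * x $ i * \<kappa> * q / A)"
    using \<open>\<kappa> \<noteq> 0\<close> by (simp add: para_field_def Let_def inv_T_para[OF assms(1)])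
  \<comment> \<open>The correction factor in the new time is proportional to \<open>A\<close>, which
    is why it clears the denominator of the derivative.\<close>
  moreover have "1 - (2 * real c - 1) / (2 * real c) * inverse \<kappa> = A / (2 * real c * \<kappa>)"
    using \<open>\<kappa> \<noteq> 0\<close> \<open>c > 0\<close> by (simp add: A_def field_simps)
  moreover have "A / (2 * real c * \<kappa>) * (g - a * \<kappa> * q / A)
      = A / (2 * real c * \<kappa>) * g - a * (q / (2 * real c))" for g a
    using \<open>\<kappa> \<noteq> 0\<close> \<open>c > 0\<close> \<open>A > 0\<close> by (simp add: field_simps)
  ultimately show ?thesis
    by (simp add: inv_\<kappa> q_def)
qed

end

theorem proposition3p11:
  fixes \<alpha> \<beta> :: "'n::finite \<Rightarrow> nat" and c k :: nat
    and f :: "real ^ 'n \<Rightarrow> real ^ 'n"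
  assumes "\<And>i. \<alpha> i \<ge> 1" and "\<And>i. \<beta> i \<ge> 1" and "c \<ge> 1" and "k \<ge> 1"
    and "\<And>i. \<alpha> i * \<beta> i = c"
    and "polynomial_function f"
    and "asymptotically_quasi_homogeneous \<alpha> k f"
  shows "\<exists>g. C1_on (para_cdisk \<beta> c) g \<and> (\<forall>x\<in>para_disk \<beta> c. g x = para_field \<alpha> \<beta> c k f x)"
proof -
  interpret quasi_parabolic \<alpha> \<beta> c
    by standard (fact assms)+
  have "\<forall>j. \<exists>F. (\<forall>d. real_polynomial_function (F d)) \<and>
    (\<forall>r x. f (quasi_scale \<alpha> r x) $ j = (\<Sum>d\<le>k + \<alpha> j. r ^ d * F d x))"
    using asymptotically_quasi_homogeneous_expansion[OF assms(1,6,7)] by blast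
  then obtain F where F: "\<And>j d. real_polynomial_function (F j d)"
    "\<And>j r x. f (quasi_scale \<alpha> r x) $ j = (\<Sum>d\<le>k + \<alpha> j. r ^ d * F j d x)"
    by metis
  define G where "G x = (\<chi> j. \<Sum>d\<le>k + \<alpha> j. (1 - para_sum \<beta> x) ^ (k + \<alpha> j - d) * F j d x)" for x
  \<comment> \<open>The right-hand side of \<open>para_field_eq\<close>, now read at every point of
    the space: with kappa eliminated it has no singularity at p = 1.\<close>
  define g where "g x = (\<chi> i. (1 - (2 * real c - 1) / (2 * real c) * (1 - para_sum \<beta> x)) * G x $ i
      - real (\<alpha> i) * x $ i * (para_sum_deriv \<beta> x (G x) / (2 * real c)))" for x
  note poly_intros = real_polynomial_function_diff real_polynomial_function.intros(2,4)
    real_polynomial_function_divide real_polynomial_function_sum real_polynomial_function_power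
    real_polynomial_function_nth real_polynomial_function_para_sum F(1) finite finite_atMost
  have G: "real_polynomial_function (\<lambda>x. G x $ j)" for j
    unfolding G_def vec_lambda_beta by (intro poly_intros)
  have "real_polynomial_function (\<lambda>x. g x $ i)" for i
    unfolding g_def vec_lambda_beta para_sum_deriv_def by (intro poly_intros G)
  then have "C1_on (para_cdisk \<beta> c) g"
    by (rule C1_on_real_polynomial_components)
  moreover have "g x = para_field \<alpha> \<beta> c k f x" if "x \<in> para_disk \<beta> c" for x
    using para_field_eq[where F = F, OF that F(2)] by (simp add: vec_eq_iff g_def G_def)
  ultimately show ?thesis by blast
qed

end
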